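(* Let $n\geq2$. Suppose there exist $\alpha\in\mathbb{R}$ with $\alpha\neq-1$, $\beta\in\mathbb{R}$, $T_*>0$, and a solution $(v,\rho)$ of the density-dependent Euler equations in $\mathbb{R}^n$ on $[0,T_* )$ which, for all $t<T_*$ sufficiently close to $T_*$, is of the form $$v(x,t)=\frac{1}{(T_*-t)^{\frac{\alpha}{\alpha+1}}}V\!\left(\frac{x}{(T_*-t)^{\frac{1}{\alpha+1}}}\right),\qquad \rho(x,t)=\frac{1}{(T_*-t)^{\beta}}R\!\left(\frac{x}{(T_*-t)^{\frac{1}{\alpha+1}}}\right),$$ and for which there exist $p_1,p_2$ with $0<p_1<p_2\leq\infty$ such that $R\in L^{p_1}(\mathbb{R}^n)\cap L^{p_2}(\mathbb{R}^n)$. Then $R=0$.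
   Context: The density-dependent Euler equations in $\mathbb{R}^n$ are $$\frac{\partial(\rho v)}{\partial t}+\mathrm{div}(\rho v\otimes v)=-\nabla p,\qquad \frac{\partial\rho}{\partial t}+v\cdot\nabla\rho=0,\qquad \mathrm{div}\,v=0,$$ with $v(x,0)=v_0(x)$, $\rho(x,0)=\rho_0(x)$, where $v=(v_1,\dots,v_n)(x,t)$ is the velocity, $\rho=\rho(x,t)\geq0$ is the scalar density and $p=p(x,t)$ is the pressure. Solutions are understood in the classical sense: $\rho$ is $C^1$, the equations hold pointwise, and $v\in C([0,T_* );C^1(\mathbb{R}^n;\mathbb{R}^n))$. The latter means that $v(\cdot,t)$ is $C^1$ in $x$ with bounded gradient, $v$ is continuous in $(x,t)$, and $t\mapsto\nabla v(\cdot,t)$ is continuous into the bounded continuous functions with the sup norm ($v$ itself need not be bounded). For $0<p<1$, $L^p(\mathbb{R}^n)$ is the set of measurable $f$ with $\int|f|^p\,dx<\infty$. *)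

theory Defs
  imports "HOL-Analysis.Analysis"
begin

text \<open>
  Fields on space-time are curried, space first: \<open>v x t\<close>. The space is \<open>real ^ 'n\<close>
  and the time interval is \<open>{0..<T}\<close>, so every time derivative is taken within
  \<open>{0..<T}\<close> and is one-sided exactly at \<open>t = 0\<close>.
\<close>

definition C1_on :: "'a set \<Rightarrow> ('a::real_normed_vector \<Rightarrow> 'b::real_normed_vector) \<Rightarrow> bool" where
  "C1_on S f \<longleftrightarrow>
    (\<exists>f' :: 'a \<Rightarrow> 'a \<Rightarrow>\<^sub>L 'b.
      (\<forall>z\<in>S. (f has_derivative blinfun_apply (f' z)) (at z within S)) \<and> continuous_on S f')"

definition divergence :: "(real^'n \<Rightarrow> real^'n) \<Rightarrow> real^'n \<Rightarrow> real" where
  "divergence F x = trace (jacobian F (at x))"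

text \<open>The divergence of a matrix field is taken row by row.\<close>

definition tensor_divergence :: "(real^'n \<Rightarrow> real^'n^'n) \<Rightarrow> real^'n \<Rightarrow> real^'n" where
  "tensor_divergence M x = (\<chi> i. divergence (\<lambda>y. M y $ i) x)"

definition outer_product :: "real^'n \<Rightarrow> real^'n \<Rightarrow> real^'n^'n" where
  "outer_product a b = (\<chi> i j. a $ i * b $ j)"

text \<open>
  The class \<open>C([0,T); C\<^sup>1)\<close> in which only the gradient, not the field itself, is bounded:
  \<open>G t\<close> is the spatial derivative of \<open>v\<close> at time \<open>t\<close>, an element of the Banach space of
  bounded continuous functions with the supremum norm.
\<close>

definition velocity_class :: "real \<Rightarrow> (real^'n \<Rightarrow> real \<Rightarrow> real^'n) \<Rightarrow> bool" where
  "velocity_class T v \<longleftrightarrow>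
    continuous_on (UNIV \<times> {0..<T}) (\<lambda>(x, t). v x t) \<and>
    (\<exists>G :: real \<Rightarrow> ((real^'n) \<Rightarrow>\<^sub>C ((real^'n) \<Rightarrow>\<^sub>L (real^'n))).
      (\<forall>t\<in>{0..<T}. \<forall>x.
        ((\<lambda>y. v y t) has_derivative blinfun_apply (apply_bcontfun (G t) x)) (at x)) \<and>
      continuous_on {0..<T} G)"

definition momentum_equation ::
    "real \<Rightarrow> (real^'n \<Rightarrow> real \<Rightarrow> real^'n) \<Rightarrow> (real^'n \<Rightarrow> real \<Rightarrow> real) \<Rightarrow>
     (real^'n \<Rightarrow> real \<Rightarrow> real) \<Rightarrow> bool" where
  "momentum_equation T v \<rho> p \<longleftrightarrow>
    (\<forall>t\<in>{0..<T}. \<forall>x. \<exists>m g.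
      ((\<lambda>s. \<rho> x s *\<^sub>R v x s) has_vector_derivative m) (at t within {0..<T}) \<and>
      GDERIV (\<lambda>y. p y t) x :> g \<and>
      m + tensor_divergence (\<lambda>y. \<rho> y t *\<^sub>R outer_product (v y t) (v y t)) x = - g)"

definition transport_equation ::
    "real \<Rightarrow> (real^'n \<Rightarrow> real \<Rightarrow> real^'n) \<Rightarrow> (real^'n \<Rightarrow> real \<Rightarrow> real) \<Rightarrow> bool" where
  "transport_equation T v \<rho> \<longleftrightarrow>
    (\<forall>t\<in>{0..<T}. \<forall>x. \<exists>r g.
      ((\<lambda>s. \<rho> x s) has_real_derivative r) (at t within {0..<T}) \<and>
      GDERIV (\<lambda>y. \<rho> y t) x :> g \<and>
      r + v x t \<bullet> g = 0)"

definition incompressible :: "real \<Rightarrow> (real^'n \<Rightarrow> real \<Rightarrow> real^'n) \<Rightarrow> bool" where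
  "incompressible T v \<longleftrightarrow> (\<forall>t\<in>{0..<T}. \<forall>x. divergence (\<lambda>y. v y t) x = 0)"

text \<open>
  The regularity conditions make \<open>v\<close> and \<open>\<rho> v \<otimes> v\<close> differentiable in space, so the
  divergences occurring in the equations are those of differentiable fields.
\<close>

definition density_dependent_euler_solution ::
    "real \<Rightarrow> (real^'n \<Rightarrow> real^'n) \<Rightarrow> (real^'n \<Rightarrow> real) \<Rightarrow>
     (real^'n \<Rightarrow> real \<Rightarrow> real^'n) \<Rightarrow> (real^'n \<Rightarrow> real \<Rightarrow> real) \<Rightarrow> bool" where
  "density_dependent_euler_solution T v\<^sub>0 \<rho>\<^sub>0 v \<rho> \<longleftrightarrow>
    velocity_class T v \<and>
    C1_on (UNIV \<times> {0..<T}) (\<lambda>(x, t). \<rho> x t) \<and>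
    (\<forall>t\<in>{0..<T}. \<forall>x. \<rho> x t \<ge> 0) \<and>
    (\<exists>p. momentum_equation T v \<rho> p) \<and>
    transport_equation T v \<rho> \<and>
    incompressible T v \<and>
    (\<forall>x. v x 0 = v\<^sub>0 x) \<and> (\<forall>x. \<rho> x 0 = \<rho>\<^sub>0 x)"

text \<open>
  Membership in \<open>L\<^sup>p\<close> for exponents \<open>0 < p \<le> \<infinity>\<close>; for \<open>p < 1\<close> this is only a set of
  functions, without a norm.
\<close>

definition in_Lp :: "ennreal \<Rightarrow> ('a::euclidean_space \<Rightarrow> real) \<Rightarrow> bool" where
  "in_Lp p f \<longleftrightarrow>
    f \<in> borel_measurable lebesgue \<and>
    (if p = \<infinity> then (\<exists>C. AE x in lebesgue. \<bar>f x\<bar> \<le> C)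
     else (\<integral>\<^sup>+ x. ennreal (\<bar>f x\<bar> powr enn2real p) \<partial>lebesgue) < \<infinity>)"

end

theory Submission
  imports Defs
begin

text \<open>
  The density is transported by a divergence-free velocity, so the measures of its level sets are
  conserved in time, while self-similarity rescales both the space and the density values. If
  \<open>\<beta> = 0\<close>, this excludes level sets \<open>{R > s}\<close> of finite nonzero measure. If \<open>\<beta> \<noteq> 0\<close>, it forces
  the measure of \<open>{R > s}\<close> to be a multiple of a power of \<open>s\<close>, and for a nonzero power law on
  \<open>(0, \<infinity>)\<close> the moment \<open>\<integral> R powr p\<close> always diverges, at \<open>0\<close> or at \<open>\<infinity>\<close>. Hence \<open>R = 0\<close>.

  The proof uses an infinitesimal form of this argument at one time \<open>t < T\<close>. Put
  \<open>\<gamma> = 1 / (\<alpha> + 1)\<close>. In similarity variables the transport equation becomes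
  \<open>W \<bullet> \<nabla>R = - \<beta> R\<close>, where \<open>W\<close> is the rescaled velocity plus the dilation field \<open>\<gamma> y\<close>
  (lemma \<open>self_similar_profile\<close>). This \<open>W\<close> has constant divergence \<open>n \<gamma> \<noteq> 0\<close>, and it grows at most
  linearly because the velocity gradient is bounded. Therefore integration by parts over the whole
  space is legitimate (lemma \<open>integral_by_parts_linear_growth\<close>) and yields
  \<open>\<beta> \<integral> R f'(R) = n \<gamma> \<integral> f(R)\<close> for suitable \<open>f\<close>. Testing with regularisations of
  the power with the exponent \<open>p\<^sub>1\<close>, which is finite as it lies below \<open>p\<^sub>2\<close>, forces \<open>R = 0\<close>
  (lemma \<open>stationary_profile_eq_0\<close>).
\<close>

section \<open>Integration by parts on the whole space\<close>

text \<open>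
  The Lebesgue measure is translation invariant, so every difference quotient of \<open>g\<close> in
  direction \<open>b\<close> has integral zero. The derivative in this direction is bounded, being continuous
  and zero outside a ball, so the mean value theorem puts all of these quotients under one multiple
  of the indicator of a larger ball, and dominated convergence passes to the derivative.
\<close>

lemma integral_directional_derivative_eq_0:
  fixes g :: "'a::euclidean_space \<Rightarrow> real"
  assumes der: "\<And>x. (g has_derivative g' x) (at x)"
    and cont: "continuous_on UNIV (\<lambda>x. g' x b)"
    and supp: "\<And>x. norm x > r \<Longrightarrow> g x = 0"
  shows "integrable lborel (\<lambda>x. g' x b)" "(\<integral>x. g' x b \<partial>lborel) = 0"
proof -
  have g'_0: "g' x b = 0" if "norm x > r" for x
  proof -
    have "open {x. norm x > r}"
      by (intro open_Collect_less continuous_intros)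
    then have "((\<lambda>_. 0) has_derivative g' x) (at x)"
      using that supp by (intro has_derivative_transform_within_open[OF der, where s = "{x. norm x > r}"]) auto
    then have "g' x = (\<lambda>_. 0)"
      by (rule has_derivative_unique) simp
    then show ?thesis by simp
  qed
  obtain K where K: "\<And>x. \<bar>g' x b\<bar> \<le> K"
  proof -
    have "compact ((\<lambda>x. g' x b) ` cball 0 r)"
      using cont by (intro compact_continuous_image) (auto intro: continuous_on_subset)
    then obtain K where K: "\<And>x. x \<in> cball 0 r \<Longrightarrow> norm (g' x b) \<le> K"
      using compact_imp_bounded bounded_iff by (metis image_eqI)
    have "\<bar>g' x b\<bar> \<le> max 0 K" for x
      using K[of x] g'_0[of x] by (cases "norm x > r") (auto simp: le_max_iff_disj)
    then show ?thesis by (rule that)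
  qed
  have K0: "0 \<le> K" using K[of 0] by linarith
  have g_cont: "continuous_on UNIV g"
    using der by (meson continuous_at_imp_continuous_on has_derivative_continuous)
  have g_meas [measurable]: "g \<in> borel_measurable borel"
    using g_cont by (rule borel_measurable_continuous_onI)
  have g_int: "integrable lborel g"
  proof -
    have "integrable lborel (\<lambda>x. indicator (cball 0 r) x *\<^sub>R g x)"
      using g_cont by (intro borel_integrable_compact) (auto intro: continuous_on_subset)
    also have "(\<lambda>x. indicator (cball 0 r) x *\<^sub>R g x) = g"
      using supp by (auto simp: fun_eq_iff indicator_def)
    finally show ?thesis .
  qed
  define q where "q m x = (g (x + b /\<^sub>R real (Suc m)) - g x) * real (Suc m)" for m x
  have shift_int: "integrable lborel (\<lambda>x. g (x + c))" and shift: "(\<integral>x. g (x + c) \<partial>lborel) = integral\<^sup>L lborel g" for c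
  proof -
    have "integrable (distr lborel borel (\<lambda>x. c + x)) g"
      using g_int by (simp add: lborel_distr_plus)
    then show "integrable lborel (\<lambda>x. g (x + c))"
      by (subst (asm) integrable_distr_eq) (auto simp: add.commute)
    have "integral\<^sup>L lborel g = integral\<^sup>L (distr lborel borel (\<lambda>x. c + x)) g"
      by (simp add: lborel_distr_plus)
    also have "\<dots> = (\<integral>x. g (x + c) \<partial>lborel)"
      by (subst integral_distr) (auto simp: add.commute)
    finally show "(\<integral>x. g (x + c) \<partial>lborel) = integral\<^sup>L lborel g" by simp
  qed
  have q_int: "integral\<^sup>L lborel (q m) = 0" for m
    unfolding q_def by (simp add: shift_int shift g_int)
  have q_lim: "(\<lambda>m. q m x) \<longlonglongrightarrow> g' x b" for x
  proof -
    have "((\<lambda>t. g (x + t *\<^sub>R b)) has_real_derivative g' x b) (at 0)"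
    proof -
      have "(g has_derivative g' x) (at (x + 0 *\<^sub>R b))" using der by simp
      then have "((\<lambda>t. g (x + t *\<^sub>R b)) has_derivative (\<lambda>t. g' x (t *\<^sub>R b))) (at 0)"
        by (rule has_derivative_compose[rotated]) (auto intro!: derivative_eq_intros)
      moreover have "g' x (t *\<^sub>R b) = t * g' x b" for t
        using linear_scale[OF has_derivative_linear[OF der]] by simp
      ultimately show ?thesis
        by (simp add: has_field_derivative_def mult.commute[of "g' x b"] mult_commute_abs)
    qed
    then have "((\<lambda>t. (g (x + t *\<^sub>R b) - g x) / t) \<longlongrightarrow> g' x b) (at 0)"
      by (simp add: DERIV_def)
    moreover have "filterlim (\<lambda>m. inverse (real (Suc m))) (at 0) sequentially"
      using LIMSEQ_inverse_real_of_nat by (simp add: filterlim_at)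
    ultimately have "(\<lambda>m. (g (x + inverse (real (Suc m)) *\<^sub>R b) - g x) / inverse (real (Suc m))) \<longlonglongrightarrow> g' x b"
      by (rule filterlim_compose)
    then show ?thesis unfolding q_def by (simp add: divide_inverse)
  qed
  have bound: "norm (q m x) \<le> K * indicator (cball 0 (r + norm b)) x" for m x
  proof (cases "x \<in> cball 0 (r + norm b)")
    case True
    obtain \<xi> where xi: "norm (g (x + b /\<^sub>R real (Suc m)) - g x) \<le> norm (g' \<xi> (b /\<^sub>R real (Suc m)))"
    proof -
      define s where "s = inverse (real (Suc m))"
      have "\<exists>t\<in>{0<..<1}. norm (g (x + 1 *\<^sub>R (s *\<^sub>R b)) - g (x + 0 *\<^sub>R (s *\<^sub>R b))) \<le> norm ((1 - 0) * g' (x + t *\<^sub>R (s *\<^sub>R b)) (s *\<^sub>R b))"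
      proof -
        have "((\<lambda>t. g (x + t *\<^sub>R (s *\<^sub>R b))) has_derivative (\<lambda>u. g' (x + t *\<^sub>R (s *\<^sub>R b)) (u *\<^sub>R (s *\<^sub>R b)))) (at t)" for t
          by (rule has_derivative_compose[OF _ der]) (auto intro!: derivative_eq_intros)
        moreover have "continuous_on {0..1} (\<lambda>t. g (x + t *\<^sub>R (s *\<^sub>R b)))"
          by (rule continuous_on_compose2[OF g_cont]) (auto intro!: continuous_intros)
        ultimately show ?thesis
          using mvt_general[of 0 1 "\<lambda>t. g (x + t *\<^sub>R (s *\<^sub>R b))"
              "\<lambda>t u. g' (x + t *\<^sub>R (s *\<^sub>R b)) (u *\<^sub>R (s *\<^sub>R b))"] by simp
      qed
      then show ?thesis using that unfolding s_def by auto
    qed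
    also have "g' \<xi> (b /\<^sub>R real (Suc m)) = g' \<xi> b / real (Suc m)"
      using linear_scale[OF has_derivative_linear[OF der]] by (simp add: divide_inverse mult.commute)
    finally have "norm (q m x) \<le> \<bar>g' \<xi> b\<bar>"
      unfolding q_def norm_mult by (simp add: field_simps del: of_nat_Suc)
    then show ?thesis using True K[of \<xi>] by simp
  next
    case False
    then have *: "norm x > r + norm b" by simp
    have "norm (b /\<^sub>R real (Suc m)) \<le> norm b"
      using mult_left_mono[of 1 "real (Suc m)" "norm b"] by (simp add: divide_simps)
    moreover have "norm x \<le> norm (x + b /\<^sub>R real (Suc m)) + norm (b /\<^sub>R real (Suc m))"
      by (metis add_diff_cancel norm_triangle_ineq4)
    ultimately have "norm (x + b /\<^sub>R real (Suc m)) > r" using * by linarith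
    moreover have "norm x > r" using * norm_ge_zero[of b] by linarith
    ultimately have "q m x = 0" unfolding q_def using supp by simp
    then show ?thesis using K0 by simp
  qed
  have dom: "integrable lborel (\<lambda>x. K * indicator (cball 0 (r + norm b)) x :: real)"
    by (intro integrable_mult_right integrable_real_indicator emeasure_lborel_cball_finite) simp
  have meas: "(\<lambda>x. g' x b) \<in> borel_measurable lborel"
    using borel_measurable_continuous_onI[OF cont] by simp
  have qmeas: "q m \<in> borel_measurable lborel" for m unfolding q_def by measurable
  show "integrable lborel (\<lambda>x. g' x b)"
    using q_lim bound by (intro integrable_dominated_convergence[OF meas qmeas dom, of "\<lambda>m. m"]) auto
  have "(\<lambda>m. integral\<^sup>L lborel (q m)) \<longlonglongrightarrow> (\<integral>x. g' x b \<partial>lborel)"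
    using q_lim bound by (intro integral_dominated_convergence[OF meas qmeas dom, of "\<lambda>m. m"]) auto
  then show "(\<integral>x. g' x b \<partial>lborel) = 0"
    unfolding q_int by (simp add: LIMSEQ_const_iff)
qed

text \<open>
  The integrand is the divergence of the compactly supported field \<open>\<phi> h W\<close>, so each of its
  coordinate terms integrates to zero.
\<close>

lemma integral_cutoff_by_parts:
  fixes h \<phi> :: "'a::euclidean_space \<Rightarrow> real" and W :: "'a \<Rightarrow> 'a"
  assumes dh: "\<And>x. (h has_derivative h' x) (at x)" and ch: "\<And>b. continuous_on UNIV (\<lambda>x. h' x b)"
    and dW: "\<And>x. (W has_derivative W' x) (at x)" and cW: "\<And>b. continuous_on UNIV (\<lambda>x. W' x b)"
    and div: "\<And>x. (\<Sum>b\<in>Basis. W' x b \<bullet> b) = d"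
    and d\<phi>: "\<And>x. (\<phi> has_derivative \<phi>' x) (at x)" and c\<phi>: "\<And>b. continuous_on UNIV (\<lambda>x. \<phi>' x b)"
    and supp: "\<And>x. norm x > r \<Longrightarrow> \<phi> x = 0"
  shows "integrable lborel (\<lambda>x. \<phi> x * (h' x (W x) + d * h x) + h x * \<phi>' x (W x))" (is "integrable _ ?I")
    and "(\<integral>x. \<phi> x * (h' x (W x) + d * h x) + h x * \<phi>' x (W x) \<partial>lborel) = 0"
proof -
  define g where "g b x = \<phi> x * (h x * (W x \<bullet> b))" for b x
  define g' where "g' b x y = \<phi>' x y * (h x * (W x \<bullet> b)) + \<phi> x * (h' x y * (W x \<bullet> b) + h x * (W' x y \<bullet> b))" for b x y
  have C: "continuous_on UNIV h" "continuous_on UNIV \<phi>" "continuous_on UNIV W"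
    using dh d\<phi> dW by (meson continuous_at_imp_continuous_on has_derivative_continuous)+
  have dg: "(g b has_derivative g' b x) (at x)" for b x
    unfolding g_def[abs_def] g'_def[abs_def]
    by (auto intro!: derivative_eq_intros dh dW d\<phi> simp: algebra_simps fun_eq_iff)
  have cg: "continuous_on UNIV (\<lambda>x. g' b x b)" for b
    unfolding g'_def by (intro continuous_intros C ch cW c\<phi>)
  have sg: "norm x > r \<Longrightarrow> g b x = 0" for b x
    by (simp add: g_def supp)
  have coords: "(\<Sum>b\<in>Basis. f b * (w \<bullet> b)) = f w" if "linear f" for f :: "'a \<Rightarrow> real" and w
  proof -
    have "f w = f (\<Sum>b\<in>Basis. (w \<bullet> b) *\<^sub>R b)" by (simp add: euclidean_representation)
    also have "\<dots> = (\<Sum>b\<in>Basis. f b * (w \<bullet> b))"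
      using that by (simp add: linear_sum linear_scale mult.commute)
    finally show ?thesis by simp
  qed
  have I: "?I = (\<lambda>x. \<Sum>b\<in>Basis. g' b x b)"
  proof
    fix x
    have "(\<Sum>b\<in>Basis. g' b x b) = h x * (\<Sum>b\<in>Basis. \<phi>' x b * (W x \<bullet> b))
        + \<phi> x * ((\<Sum>b\<in>Basis. h' x b * (W x \<bullet> b)) + h x * (\<Sum>b\<in>Basis. W' x b \<bullet> b))"
      unfolding g'_def by (simp add: sum.distrib sum_distrib_left distrib_left mult_ac)
    then show "?I x = (\<Sum>b\<in>Basis. g' b x b)"
      using coords[OF has_derivative_linear[OF dh]] coords[OF has_derivative_linear[OF d\<phi>]] div
      by (simp add: mult.commute)
  qed
  note int = integral_directional_derivative_eq_0[OF dg cg sg]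
  show "integrable lborel ?I" unfolding I using int(1) by auto
  show "integral\<^sup>L lborel ?I = 0" unfolding I using int by (simp add: integral_sum)
qed

text \<open>
  Composed with \<open>1 - |x|\<^sup>2 / s\<^sup>2\<close>, this function gives a continuously differentiable cutoff
  with support in the ball of radius \<open>s\<close>.
\<close>

lemma DERIV_max_0_square: "((\<lambda>u::real. (max 0 u)\<^sup>2) has_real_derivative 2 * max 0 u) (at u)"
proof -
  consider "u > 0" | "u < 0" | "u = 0" by linarith
  then show ?thesis
  proof cases
    case 1
    have "((\<lambda>u::real. u\<^sup>2) has_real_derivative 2 * max 0 u) (at u)"
      using 1 by (auto intro!: derivative_eq_intros)
    then show ?thesis
      by (rule has_field_derivative_transform_within_open[where S = "{0<..}"]) (use 1 in auto)
  next
    case 2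
    have "((\<lambda>u::real. 0) has_real_derivative 2 * max 0 u) (at u)"
      using 2 by (auto intro!: derivative_eq_intros)
    then show ?thesis
      by (rule has_field_derivative_transform_within_open[where S = "{..<0}"]) (use 2 in auto)
  next
    case 3
    have "((\<lambda>y::real. max 0 y) \<longlongrightarrow> max 0 0) (at 0)"
      by (intro tendsto_intros)
    moreover have "(max 0 y)\<^sup>2 / y = max 0 y" for y :: real
      by (auto simp: max_def power2_eq_square)
    ultimately show ?thesis
      using 3 by (simp add: has_field_derivative_iff)
  qed
qed

text \<open>
  The boundary term at infinity vanishes for fields of linear growth: the gradient of a cutoff at
  scale \<open>s\<close> has size \<open>1 / s\<close> and lives on the ball of radius \<open>s\<close>, where \<open>|W|\<close> is of order \<open>s\<close>.
  The product \<open>\<nabla>\<phi> \<bullet> W\<close> is therefore bounded uniformly in \<open>s\<close>, and it tends to zero pointwise,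
  which suffices for dominated convergence because \<open>h\<close> is integrable.
\<close>

lemma integral_by_parts_linear_growth:
  fixes h :: "'a::euclidean_space \<Rightarrow> real" and W :: "'a \<Rightarrow> 'a"
  assumes dh: "\<And>x. (h has_derivative h' x) (at x)" and ch: "\<And>b. continuous_on UNIV (\<lambda>x. h' x b)"
    and dW: "\<And>x. (W has_derivative W' x) (at x)" and cW: "\<And>b. continuous_on UNIV (\<lambda>x. W' x b)"
    and div: "\<And>x. (\<Sum>b\<in>Basis. W' x b \<bullet> b) = d"
    and growth: "\<And>x. norm (W x) \<le> C * (1 + norm x)"
    and ih: "integrable lborel h" and iq: "integrable lborel (\<lambda>x. h' x (W x))"
  shows "(\<integral>x. h' x (W x) + d * h x \<partial>lborel) = 0"
proof -
  have C0: "C \<ge> 0" using order_trans[OF norm_ge_zero growth[of 0]] by simp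
  define \<phi> where "\<phi> m x = (max 0 (1 - (x \<bullet> x) / (real (Suc m))\<^sup>2))\<^sup>2" for m and x :: 'a
  define \<phi>' where "\<phi>' m x y = 2 * max 0 (1 - (x \<bullet> x) / (real (Suc m))\<^sup>2) * (- (2 * (x \<bullet> y) / (real (Suc m))\<^sup>2))"
    for m and x y :: 'a
  define I where "I m x = \<phi> m x * (h' x (W x) + d * h x) + h x * \<phi>' m x (W x)" for m x
  have d\<phi>: "(\<phi> m has_derivative \<phi>' m x) (at x)" for m x
  proof -
    have *: "((\<lambda>x::'a. 1 - (x \<bullet> x) / (real (Suc m))\<^sup>2) has_derivative (\<lambda>y. - (2 * (x \<bullet> y) / (real (Suc m))\<^sup>2))) (at x)"
      unfolding divide_inverse
      by (auto intro!: derivative_eq_intros simp: inner_commute fun_eq_iff simp del: of_nat_Suc)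
    show ?thesis
      unfolding \<phi>_def[abs_def] \<phi>'_def[abs_def]
      using has_derivative_compose[OF * DERIV_max_0_square[unfolded has_field_derivative_def]] by simp
  qed
  have c\<phi>: "continuous_on UNIV (\<lambda>x. \<phi>' m x b)" for m b
    unfolding \<phi>'_def by (intro continuous_intros) auto
  have outside: "max 0 (1 - (x \<bullet> x) / (real (Suc m))\<^sup>2) = 0" if "norm x > real (Suc m)" for m and x :: 'a
  proof -
    have "(real (Suc m))\<^sup>2 \<le> (norm x)\<^sup>2" using that by (intro power_mono) auto
    then show ?thesis by (simp add: power2_norm_eq_inner del: of_nat_Suc)
  qed
  have s\<phi>: "\<phi> m x = 0" if "norm x > real (Suc m)" for m x
    unfolding \<phi>_def outside[OF that] by simp
  have I_int: "integrable lborel (I m)" and I_0: "integral\<^sup>L lborel (I m) = 0" for m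
    unfolding I_def[abs_def]
    using integral_cutoff_by_parts[OF dh ch dW cW div d\<phi> c\<phi> s\<phi>] by blast+
  have r: "(\<lambda>m. c / (real (Suc m))\<^sup>2) \<longlonglongrightarrow> 0" for c :: real
    using tendsto_mult[OF tendsto_const[of c] tendsto_power[OF LIMSEQ_inverse_real_of_nat, of 2]]
    by (simp add: divide_inverse power_inverse)
  have lim: "(\<lambda>m. I m x) \<longlonglongrightarrow> h' x (W x) + d * h x" for x
  proof -
    have "(\<lambda>m. I m x) \<longlonglongrightarrow> (max 0 (1 - 0))\<^sup>2 * (h' x (W x) + d * h x) + h x * (2 * max 0 (1 - 0) * (- 0))"
      unfolding I_def \<phi>_def \<phi>'_def by (intro tendsto_intros r)
    then show ?thesis by simp
  qed
  have bound: "norm (I m x) \<le> \<bar>h' x (W x) + d * h x\<bar> + \<bar>h x\<bar> * (8 * C)" for m x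
  proof -
    define s where "s = real (Suc m)"
    have s: "s \<ge> 1" by (simp add: s_def)
    define u where "u = max 0 (1 - (x \<bullet> x) / s\<^sup>2)"
    have u: "0 \<le> u" "u \<le> 1" by (auto simp: u_def)
    have \<phi>u: "\<phi> m x = u\<^sup>2" "\<phi>' m x (W x) = 2 * u * (- (2 * (x \<bullet> W x) / s\<^sup>2))"
      by (simp_all add: \<phi>_def \<phi>'_def u_def s_def)
    have "\<bar>\<phi> m x\<bar> \<le> 1" using u by (simp add: \<phi>u power_le_one)
    moreover have "\<bar>\<phi>' m x (W x)\<bar> \<le> 8 * C"
    proof (cases "norm x > s")
      case True
      then have "u = 0" using outside unfolding u_def s_def by blast
      then show ?thesis using C0 by (simp add: \<phi>u)
    next
      case False
      have "\<bar>x \<bullet> W x\<bar> \<le> norm x * norm (W x)" by (rule Cauchy_Schwarz_ineq2)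
      also have "\<dots> \<le> s * (C * (1 + norm x))"
        using False s by (intro mult_mono growth) auto
      also have "\<dots> \<le> s * (C * (2 * s))"
        using False s C0 by (intro mult_left_mono) auto
      finally have "\<bar>x \<bullet> W x\<bar> / s\<^sup>2 \<le> 2 * C"
        using s by (simp add: divide_simps power2_eq_square mult_ac)
      then have "u * (\<bar>x \<bullet> W x\<bar> / s\<^sup>2) \<le> 1 * (2 * C)"
        using u by (intro mult_mono) auto
      then show ?thesis using u by (simp add: \<phi>u abs_mult)
    qed
    ultimately have "\<bar>\<phi> m x\<bar> * \<bar>h' x (W x) + d * h x\<bar> + \<bar>h x\<bar> * \<bar>\<phi>' m x (W x)\<bar>
        \<le> 1 * \<bar>h' x (W x) + d * h x\<bar> + \<bar>h x\<bar> * (8 * C)"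
      by (intro add_mono mult_right_mono mult_left_mono) auto
    then show ?thesis
      unfolding I_def real_norm_def abs_mult[symmetric] by (intro order_trans[OF abs_triangle_ineq]) simp
  qed
  have "(\<lambda>m. integral\<^sup>L lborel (I m)) \<longlonglongrightarrow> (\<integral>x. h' x (W x) + d * h x \<partial>lborel)"
  proof (rule integral_dominated_convergence)
    show "integrable lborel (\<lambda>x. \<bar>h' x (W x) + d * h x\<bar> + \<bar>h x\<bar> * (8 * C))"
      using ih iq by simp
    show "(\<lambda>x. h' x (W x) + d * h x) \<in> borel_measurable lborel"
      using ih iq by (intro borel_measurable_integrable) simp
  qed (use I_int lim bound in auto)
  then show ?thesis unfolding I_0 by (simp add: LIMSEQ_const_iff)
qed

lemma continuous_nonneg_integral_eq_0:
  fixes f :: "'a::euclidean_space \<Rightarrow> real"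
  assumes cont: "continuous_on UNIV f" and nonneg: "\<And>x. f x \<ge> 0"
    and int: "integrable lborel f" and zero: "integral\<^sup>L lborel f = 0"
  shows "f x = 0"
proof -
  have "AE x in lborel. f x = 0"
    using integral_nonneg_eq_0_iff_AE[OF int] nonneg zero by simp
  moreover have op: "open {x. f x \<noteq> 0}"
    using cont by (intro open_Collect_neq) auto
  ultimately have "{x. f x \<noteq> 0} \<in> null_sets lborel"
    by (simp add: AE_iff_null_sets)
  then have "negligible {x. f x \<noteq> 0}"
    by (simp add: negligible_iff_null_sets null_sets_completionI)
  then show ?thesis using open_not_negligible[OF op] by auto
qed

section \<open>Stationary profiles under a drift of constant divergence\<close>

text \<open>
  For suitable \<open>f\<close>, integration by parts of \<open>f \<circ> R\<close> against \<open>W\<close> gives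
  \<open>\<integral> (d f(R) - \<beta> R f'(R)) = 0\<close>. With \<open>f s = s powr p\<close> this would read
  \<open>(d - \<beta> p) \<integral> R powr p = 0\<close>, but for \<open>p < 1\<close> that power is not differentiable at \<open>0\<close>.
  The function \<open>f \<epsilon> s = s ^ N * (s + \<epsilon>) powr (p - N)\<close> with \<open>N > p\<close> is smooth on \<open>s \<ge> 0\<close>,
  lies below \<open>s powr p\<close>, tends to it as \<open>\<epsilon>\<close> tends to 0, and satisfies
  \<open>s f'(s) = f(s) (p + (N - p) \<epsilon> / (s + \<epsilon>))\<close>. So the limit \<open>\<epsilon> \<rightarrow> 0\<close> proves the identity for the
  pure power, and \<open>R\<close> vanishes unless \<open>d = \<beta> p\<close>.

  In that resonant case the value \<open>\<epsilon> = 1\<close> decides: the multiples \<open>d\<close> and \<open>\<beta> p\<close> of \<open>f(R)\<close>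
  cancel and leave \<open>\<beta> (N - p) \<integral> f(R) / (R + 1) = 0\<close>, an integral of a nonnegative function, with
  \<open>\<beta> \<noteq> 0\<close> because \<open>d \<noteq> 0\<close>. This reflects that the measure of \<open>{R > s}\<close> would be proportional to
  \<open>s powr (- p)\<close>, and for such a law \<open>\<integral> R powr p\<close> diverges logarithmically.
\<close>

lemma stationary_profile_eq_0:
  fixes R :: "'a::euclidean_space \<Rightarrow> real" and W :: "'a \<Rightarrow> 'a"
  assumes dR: "\<And>x. (R has_derivative R' x) (at x)" and cR: "\<And>b. continuous_on UNIV (\<lambda>x. R' x b)"
    and R0: "\<And>x. R x \<ge> 0"
    and dW: "\<And>x. (W has_derivative W' x) (at x)" and cW: "\<And>b. continuous_on UNIV (\<lambda>x. W' x b)"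
    and div: "\<And>x. (\<Sum>b\<in>Basis. W' x b \<bullet> b) = d" and d0: "d \<noteq> 0"
    and growth: "\<And>x. norm (W x) \<le> C * (1 + norm x)"
    and eq: "\<And>x. R' x (W x) = - \<beta> * R x"
    and p0: "p > 0" and Rp: "integrable lborel (\<lambda>x. R x powr p)"
  shows "R x = 0"
proof -
  obtain N :: nat where N: "real N > p" using reals_Archimedean2 by blast
  then have N1: "N \<ge> 1" using p0 by (cases N) auto
  define f where "f \<epsilon> s = s ^ N * (s + \<epsilon>) powr (p - real N)" for \<epsilon> s :: real
  \<comment> \<open>The integrand obtained from \<open>f \<epsilon>\<close>; its integral is shown to vanish for every \<open>\<epsilon> > 0\<close>.\<close>
  define I where "I \<epsilon> x = f \<epsilon> (R x) * (d - \<beta> * p - \<beta> * (real N - p) * (\<epsilon> / (R x + \<epsilon>)))" for \<epsilon> x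
  define K where "K = \<bar>d\<bar> + \<bar>\<beta>\<bar> * p + \<bar>\<beta>\<bar> * (real N - p)"
  have CR: "continuous_on UNIV R"
    using dR by (meson continuous_at_imp_continuous_on has_derivative_continuous)
  have f0: "0 \<le> f \<epsilon> s" if "s \<ge> 0" for \<epsilon> s
    using that by (simp add: f_def)
  have f_le: "f \<epsilon> s \<le> s powr p" if "\<epsilon> > 0" "s \<ge> 0" for \<epsilon> s
  proof (cases "s = 0")
    case True then show ?thesis using N1 by (simp add: f_def power_0_left)
  next
    case False
    then have "s > 0" using that by simp
    have "f \<epsilon> s \<le> s ^ N * s powr (p - real N)"
      unfolding f_def using that N \<open>s > 0\<close> by (intro mult_left_mono powr_mono2') auto
    also have "\<dots> = s powr p"
      using \<open>s > 0\<close> by (simp add: powr_realpow[symmetric] powr_add[symmetric])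
    finally show ?thesis .
  qed
  have ratio: "0 \<le> \<epsilon> / (R x + \<epsilon>)" "\<epsilon> / (R x + \<epsilon>) \<le> 1" if "\<epsilon> > 0" for \<epsilon> x
    using that R0[of x] by (auto simp: divide_simps)
  have cf: "continuous_on UNIV (\<lambda>x. f \<epsilon> (R x))" if "\<epsilon> > 0" for \<epsilon>
    unfolding f_def using that R0 by (intro continuous_intros CR) (metis add_nonneg_pos less_irrefl)
  have cratio: "continuous_on UNIV (\<lambda>x. \<epsilon> / (R x + \<epsilon>))" if "\<epsilon> > 0" for \<epsilon>
    using that R0 by (intro continuous_intros CR) (metis add_nonneg_pos less_irrefl)
  have int_mult: "integrable lborel (\<lambda>x. f \<epsilon> (R x) * k x)"
    if "\<epsilon> > 0" "continuous_on UNIV k" "\<And>x. \<bar>k x\<bar> \<le> B" for \<epsilon> k B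
  proof (rule Bochner_Integration.integrable_bound)
    show "integrable lborel (\<lambda>x. B * R x powr p)" using Rp by simp
    have "continuous_on UNIV (\<lambda>x. f \<epsilon> (R x) * k x)"
      using cf that by (intro continuous_intros) auto
    then show "(\<lambda>x. f \<epsilon> (R x) * k x) \<in> borel_measurable lborel"
      using borel_measurable_continuous_onI by simp
    have "\<bar>k x\<bar> * f \<epsilon> (R x) \<le> B * R x powr p" for x
      using that f_le[OF \<open>\<epsilon> > 0\<close> R0] f0[OF R0] order_trans[OF abs_ge_zero that(3)]
      by (intro mult_mono) auto
    then show "AE x in lborel. norm (f \<epsilon> (R x) * k x) \<le> norm (B * R x powr p)"
      using f0[OF R0] by (intro AE_I2 order_trans[OF _ abs_ge_self[of "B * _", folded real_norm_def]])
        (simp add: abs_mult mult.commute)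
  qed
  have I_0: "integral\<^sup>L lborel (I \<epsilon>) = 0" if e: "\<epsilon> > 0" for \<epsilon>
  proof -
    define f' where "f' s = real N * s ^ (N - 1) * (s + \<epsilon>) powr (p - real N)
      + s ^ N * ((p - real N) * (s + \<epsilon>) powr (p - real N - 1))" for s
    have pos: "R x + \<epsilon> > 0" for x using e R0[of x] by linarith
    have df: "(f \<epsilon> has_real_derivative f' s) (at s)" if "s + \<epsilon> > 0" for s
      unfolding f_def[abs_def] f'_def using that
      by (auto intro!: derivative_eq_intros)
    have dh: "((\<lambda>x. f \<epsilon> (R x)) has_derivative (\<lambda>y. f' (R x) * R' x y)) (at x)" for x
      using has_derivative_compose[OF dR df[OF pos, unfolded has_field_derivative_def]] .
    have ch: "continuous_on UNIV (\<lambda>x. f' (R x) * R' x b)" for b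
      unfolding f'_def using pos by (intro continuous_intros CR cR) (metis less_irrefl)+
    \<comment> \<open>For the pure power this is the Euler relation with factor \<open>p\<close>; the regularisation
        adds the term with \<open>N - p\<close>.\<close>
    have euler: "f' (R x) * R x = f \<epsilon> (R x) * (p + (real N - p) * (\<epsilon> / (R x + \<epsilon>)))" for x
    proof -
      obtain M where M: "N = Suc M" using N1 by (cases N) auto
      have "(R x + \<epsilon>) powr (p - real N) = (R x + \<epsilon>) powr (p - real N - 1) * (R x + \<epsilon>)"
        using pos[of x] powr_add[of "R x + \<epsilon>" "p - real N - 1" 1] by simp
      then show ?thesis
        unfolding f'_def f_def using pos[of x] by (simp add: M field_simps)
    qed
    have hW: "f' (R x) * R' x (W x) = f \<epsilon> (R x) * (- \<beta> * (p + (real N - p) * (\<epsilon> / (R x + \<epsilon>))))" for x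
      using euler[of x] by (simp add: eq mult.assoc mult.left_commute)
    have ih: "integrable lborel (\<lambda>x. f \<epsilon> (R x))"
      using int_mult[OF e, of "\<lambda>_. 1" 1] by simp
    have iq: "integrable lborel (\<lambda>x. f' (R x) * R' x (W x))"
      unfolding hW
    proof (rule int_mult[OF e, where B = "\<bar>\<beta>\<bar> * (p + (real N - p) * 1)"])
      show "continuous_on UNIV (\<lambda>x. - \<beta> * (p + (real N - p) * (\<epsilon> / (R x + \<epsilon>))))"
        by (intro continuous_on_mult continuous_on_add continuous_on_const cratio[OF e])
      have "\<bar>p + (real N - p) * (\<epsilon> / (R x + \<epsilon>))\<bar> \<le> p + (real N - p) * 1" for x
      proof -
        have "(real N - p) * (\<epsilon> / (R x + \<epsilon>)) \<le> (real N - p) * 1"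
          using ratio[OF e, of x] N by (intro mult_left_mono) auto
        moreover have "0 \<le> (real N - p) * (\<epsilon> / (R x + \<epsilon>))"
          using ratio[OF e, of x] N by (intro mult_nonneg_nonneg) auto
        ultimately show ?thesis using p0 by linarith
      qed
      then show "\<bar>- \<beta> * (p + (real N - p) * (\<epsilon> / (R x + \<epsilon>)))\<bar> \<le> \<bar>\<beta>\<bar> * (p + (real N - p) * 1)" for x
        unfolding abs_mult by (intro mult_mono) auto
    qed
    have "I \<epsilon> = (\<lambda>x. f' (R x) * R' x (W x) + d * f \<epsilon> (R x))"
    proof
      fix x
      have "c * (d - \<beta> * p - \<beta> * (real N - p) * t) = c * (- \<beta> * (p + (real N - p) * t)) + d * c" for c t
        by (simp add: algebra_simps)
      then show "I \<epsilon> x = f' (R x) * R' x (W x) + d * f \<epsilon> (R x)"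
        unfolding I_def hW .
    qed
    then show ?thesis
      using integral_by_parts_linear_growth[OF dh ch dW cW div growth ih iq] by simp
  qed
  \<comment> \<open>The limit \<open>\<epsilon> \<rightarrow> 0\<close>, along \<open>\<epsilon> = 1 / (m + 1)\<close> and dominated by a multiple of \<open>R powr p\<close>.\<close>
  have "(\<lambda>m. integral\<^sup>L lborel (I (inverse (real (Suc m))))) \<longlonglongrightarrow> (\<integral>x. R x powr p * (d - \<beta> * p) \<partial>lborel)"
  proof (rule integral_dominated_convergence)
    show "integrable lborel (\<lambda>x. R x powr p * K)" using Rp by simp
    show "(\<lambda>x. R x powr p * (d - \<beta> * p)) \<in> borel_measurable lborel"
      using borel_measurable_integrable[OF Rp] by simp
    show "I (inverse (real (Suc m))) \<in> borel_measurable lborel" for m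
    proof -
      have e: "inverse (real (Suc m)) > 0" by simp
      have "continuous_on UNIV (I (inverse (real (Suc m))))"
        unfolding I_def[abs_def] by (intro continuous_on_mult continuous_on_diff continuous_on_const cf[OF e] cratio[OF e])
      then show ?thesis using borel_measurable_continuous_onI by simp
    qed
    show "AE x in lborel. (\<lambda>m. I (inverse (real (Suc m))) x) \<longlonglongrightarrow> R x powr p * (d - \<beta> * p)"
    proof (rule AE_I2)
      fix x
      show "(\<lambda>m. I (inverse (real (Suc m))) x) \<longlonglongrightarrow> R x powr p * (d - \<beta> * p)"
      proof (cases "R x = 0")
        case True
        then have "I \<epsilon> x = 0" for \<epsilon> using N1 by (simp add: I_def f_def power_0_left)
        then show ?thesis using True by simp
      next
        case False
        then have pos: "R x > 0" using R0[of x] by linarith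
        have "(\<lambda>m. I (inverse (real (Suc m))) x) \<longlonglongrightarrow>
          R x ^ N * (R x + 0) powr (p - real N) * (d - \<beta> * p - \<beta> * (real N - p) * (0 / (R x + 0)))"
          unfolding I_def f_def using pos by (intro tendsto_intros LIMSEQ_inverse_real_of_nat) auto
        also have "R x ^ N * (R x + 0) powr (p - real N) = R x powr p"
          using pos by (simp add: powr_realpow[symmetric] powr_add[symmetric])
        finally show ?thesis by simp
      qed
    qed
    show "AE x in lborel. norm (I (inverse (real (Suc m))) x) \<le> R x powr p * K" for m
    proof (rule AE_I2)
      fix x
      define \<theta> where "\<theta> = inverse (real (Suc m)) / (R x + inverse (real (Suc m)))"
      have th: "0 \<le> \<theta>" "\<theta> \<le> 1" unfolding \<theta>_def by (rule ratio; simp)+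
      have "\<bar>d - \<beta> * p - \<beta> * (real N - p) * \<theta>\<bar> \<le> \<bar>d\<bar> + \<bar>\<beta> * p\<bar> + \<bar>\<beta> * (real N - p) * \<theta>\<bar>"
        by linarith
      also have "\<dots> \<le> K"
        using th N p0 by (simp add: K_def abs_mult mult_left_le)
      finally have "\<bar>f (inverse (real (Suc m))) (R x)\<bar> * \<bar>d - \<beta> * p - \<beta> * (real N - p) * \<theta>\<bar> \<le> R x powr p * K"
        using f_le[of "inverse (real (Suc m))" "R x"] f0[of "R x" "inverse (real (Suc m))"] R0[of x]
        by (intro mult_mono) auto
      then show "norm (I (inverse (real (Suc m))) x) \<le> R x powr p * K"
        by (simp add: I_def \<theta>_def abs_mult)
    qed
  qed
  moreover have "integral\<^sup>L lborel (I (inverse (real (Suc m)))) = 0" for m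
    by (rule I_0) simp
  ultimately have lim: "(\<integral>x. R x powr p \<partial>lborel) * (d - \<beta> * p) = 0"
    by (simp add: LIMSEQ_const_iff)
  show ?thesis
  proof (cases "d = \<beta> * p")
    case False
    then have "(\<integral>x. R x powr p \<partial>lborel) = 0" using lim by simp
    moreover have "continuous_on UNIV (\<lambda>x. R x powr p)"
      using R0 p0 by (intro continuous_on_powr' CR) auto
    ultimately have "R x powr p = 0"
      using Rp by (intro continuous_nonneg_integral_eq_0[where f = "\<lambda>x. R x powr p"]) auto
    then show ?thesis by simp
  next
    case True
    \<comment> \<open>In the resonant case \<open>I 1\<close> is a nonzero multiple of the nonnegative function \<open>k\<close>.\<close>
    define k where "k x = f 1 (R x) * (1 / (R x + 1))" for x
    have kI: "I 1 = (\<lambda>x. (- \<beta> * (real N - p)) * k x)"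
    proof
      fix x
      have "c * (\<beta> * p - \<beta> * p - \<beta> * (real N - p) * t) = - \<beta> * (real N - p) * (c * t)" for c t
        by simp
      then show "I 1 x = - \<beta> * (real N - p) * k x"
        unfolding I_def k_def True .
    qed
    have ck: "continuous_on UNIV k"
      unfolding k_def by (intro continuous_on_mult cf cratio) auto
    have ik: "integrable lborel k"
      unfolding k_def
    proof (rule int_mult[where B = 1])
      show "\<bar>1 / (R x + 1)\<bar> \<le> 1" for x
        using ratio[of 1 x] by (simp only: abs_of_nonneg zero_less_one simp_thms)
    qed (simp_all add: cratio)
    have k0: "k x \<ge> 0" for x
      unfolding k_def using f0[OF R0] ratio(1)[of 1] by (intro mult_nonneg_nonneg) auto
    have "(- \<beta> * (real N - p)) * integral\<^sup>L lborel k = 0"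
      using I_0[of 1] unfolding kI by simp
    moreover have "\<beta> \<noteq> 0" using True d0 by auto
    ultimately have "integral\<^sup>L lborel k = 0" using N by simp
    then have "k x = 0"
      by (rule continuous_nonneg_integral_eq_0[OF ck k0 ik])
    moreover have "R x + 1 > 0" using R0[of x] by linarith
    ultimately show ?thesis by (auto simp: k_def f_def)
  qed
qed

section \<open>From the self-similar density to its profile\<close>

text \<open>
  The scaling turns the transport equation at the single time \<open>t\<close> into a stationary one, with the
  dilation field \<open>\<gamma> y\<close> added to the rescaled velocity. The reason is that
  \<open>(T - s) powr \<beta> * \<rho> ((T - s) powr \<gamma> *\<^sub>R y) s\<close> does not depend on \<open>s\<close>: it equals \<open>R y\<close>.
  Differentiating it at \<open>s = t\<close> gives the derivative of \<open>\<rho>\<close> along a space-time curve, and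
  subtracting the space-time direction \<open>(u, 1)\<close>, along which \<open>\<rho>\<close> is constant to first order, leaves
  a purely spatial derivative.
\<close>

lemma self_similar_profile:
  fixes \<rho> :: "'a::euclidean_space \<Rightarrow> real \<Rightarrow> real" and u :: "'a \<Rightarrow> 'a"
  assumes t: "a < t" "t < T"
    and form: "\<And>s x. a < s \<Longrightarrow> s < T \<Longrightarrow> \<rho> x s = (1 / (T - s) powr \<beta>) * R (x /\<^sub>R (T - s) powr \<gamma>)"
    and D: "\<And>x. ((\<lambda>(x, s). \<rho> x s) has_derivative D x) (at (x, t))"
    and transport: "\<And>x. D x (u x, 1) = 0"
  defines "R' \<equiv> \<lambda>y z. (T - t) powr \<beta> * D ((T - t) powr \<gamma> *\<^sub>R y) ((T - t) powr \<gamma> *\<^sub>R z, 0)"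
  shows "(R has_derivative R' y) (at y)"
    and "R' y ((T - t) powr (1 - \<gamma>) *\<^sub>R u ((T - t) powr \<gamma> *\<^sub>R y) + \<gamma> *\<^sub>R y) = - \<beta> * R y"
proof -
  define \<tau> where "\<tau> = T - t"
  define L where "L = \<tau> powr \<gamma>"
  have \<tau>: "\<tau> > 0" using t by (simp add: \<tau>_def)
  have R: "R y = (T - s) powr \<beta> * \<rho> ((T - s) powr \<gamma> *\<^sub>R y) s" if "a < s" "s < T" for s y
    using that by (simp add: form)
  have R_t: "R = (\<lambda>y. \<tau> powr \<beta> * \<rho> (L *\<^sub>R y) t)"
    using R[OF t] by (simp add: \<tau>_def L_def fun_eq_iff)
  show "(R has_derivative R' y) (at y)"
  proof -
    have "((\<lambda>y. (L *\<^sub>R y, t)) has_derivative (\<lambda>z. (L *\<^sub>R z, 0))) (at y)"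
      by (auto intro!: derivative_eq_intros)
    from has_derivative_compose[OF this D]
    have "((\<lambda>y. \<rho> (L *\<^sub>R y) t) has_derivative (\<lambda>z. D (L *\<^sub>R y) (L *\<^sub>R z, 0))) (at y)" by simp
    then show ?thesis
      unfolding R_t R'_def L_def \<tau>_def by (intro has_derivative_mult_right)
  qed
  \<comment> \<open>The spatial velocity at time \<open>t\<close> of the curve \<open>s \<mapsto> (T - s) powr \<gamma> *\<^sub>R y\<close>.\<close>
  define z where "z = (- \<gamma> * \<tau> powr (\<gamma> - 1)) *\<^sub>R y"
  interpret D: bounded_linear "D (L *\<^sub>R y)" using D by (rule has_derivative_bounded_linear)
  have "((\<lambda>s. \<rho> ((T - s) powr \<gamma> *\<^sub>R y) s) has_real_derivative D (L *\<^sub>R y) (z, 1)) (at t)"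
  proof -
    have "((\<lambda>s. (T - s) powr \<gamma>) has_real_derivative - \<gamma> * \<tau> powr (\<gamma> - 1)) (at t)"
      using t by (auto intro!: derivative_eq_intros simp: \<tau>_def)
    then have "((\<lambda>s. ((T - s) powr \<gamma> *\<^sub>R y, s)) has_derivative (\<lambda>h. (((- \<gamma> * \<tau> powr (\<gamma> - 1)) * h) *\<^sub>R y, h))) (at t)"
      unfolding has_field_derivative_def by (intro has_derivative_Pair has_derivative_scaleR_left has_derivative_ident)
    moreover have "((\<lambda>(x, s). \<rho> x s) has_derivative D (L *\<^sub>R y)) (at ((T - t) powr \<gamma> *\<^sub>R y, t))"
      using D by (simp add: L_def \<tau>_def)
    ultimately have "((\<lambda>s. \<rho> ((T - s) powr \<gamma> *\<^sub>R y) s) has_derivative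
        (\<lambda>h. D (L *\<^sub>R y) (((- \<gamma> * \<tau> powr (\<gamma> - 1)) * h) *\<^sub>R y, h))) (at t)"
      using has_derivative_compose by fastforce
    moreover have "D (L *\<^sub>R y) (((- \<gamma> * \<tau> powr (\<gamma> - 1)) * h) *\<^sub>R y, h) = D (L *\<^sub>R y) (z, 1) * h" for h
      using D.scaleR[of h "(z, 1)"] by (simp add: z_def mult_ac)
    ultimately show ?thesis by (simp add: has_field_derivative_def)
  qed
  then have "((\<lambda>s. (T - s) powr \<beta> * \<rho> ((T - s) powr \<gamma> *\<^sub>R y) s) has_real_derivative
      - \<beta> * \<tau> powr (\<beta> - 1) * \<rho> (L *\<^sub>R y) t + \<tau> powr \<beta> * D (L *\<^sub>R y) (z, 1)) (at t)"
    using t by (auto intro!: derivative_eq_intros simp: \<tau>_def L_def)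
  moreover have "((\<lambda>s. (T - s) powr \<beta> * \<rho> ((T - s) powr \<gamma> *\<^sub>R y) s) has_real_derivative 0) (at t)"
    by (rule has_field_derivative_transform_within_open[where f = "\<lambda>_. R y" and S = "{a<..<T}"])
      (use t R[symmetric] in \<open>auto intro!: derivative_eq_intros\<close>)
  ultimately have conserved: "\<tau> powr \<beta> * D (L *\<^sub>R y) (z, 1) = \<beta> * \<tau> powr (\<beta> - 1) * \<rho> (L *\<^sub>R y) t"
    using DERIV_unique by fastforce
  have "L *\<^sub>R (\<tau> powr (1 - \<gamma>) *\<^sub>R u (L *\<^sub>R y) + \<gamma> *\<^sub>R y) = (- \<tau>) *\<^sub>R (z - u (L *\<^sub>R y))"
  proof -
    have "L * \<tau> powr (1 - \<gamma>) = \<tau>" "\<tau> * \<tau> powr (\<gamma> - 1) = L"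
      using \<tau> by (simp_all add: L_def powr_add[symmetric] powr_mult_base)
    then show ?thesis by (simp add: z_def algebra_simps)
  qed
  then have "R' y (\<tau> powr (1 - \<gamma>) *\<^sub>R u (L *\<^sub>R y) + \<gamma> *\<^sub>R y) = \<tau> powr \<beta> * D (L *\<^sub>R y) ((- \<tau>) *\<^sub>R ((z, 1) - (u (L *\<^sub>R y), 1)))"
    by (simp add: R'_def L_def \<tau>_def)
  also have "\<dots> = - \<tau> * (\<tau> powr \<beta> * D (L *\<^sub>R y) (z, 1))"
    by (simp only: D.scaleR D.diff transport) simp
  also have "\<dots> = - \<beta> * ((\<tau> * \<tau> powr (\<beta> - 1)) * \<rho> (L *\<^sub>R y) t)"
    unfolding conserved by simp
  also have "\<dots> = - \<beta> * R y"
    using \<tau> by (simp add: R_t powr_mult_base)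
  finally show "R' y ((T - t) powr (1 - \<gamma>) *\<^sub>R u ((T - t) powr \<gamma> *\<^sub>R y) + \<gamma> *\<^sub>R y) = - \<beta> * R y"
    by (simp add: L_def \<tau>_def)
qed

lemma divergence_eq_sum_Basis:
  fixes F :: "real^'n \<Rightarrow> real^'n"
  assumes "(F has_derivative F') (at x)"
  shows "divergence F x = (\<Sum>b\<in>Basis. F' b \<bullet> b)"
proof -
  have "(\<Sum>b\<in>Basis. F' b \<bullet> b) = (\<Sum>i\<in>UNIV. F' (axis i 1) \<bullet> axis i 1)"
  proof -
    have B: "(Basis :: (real^'n) set) = range (\<lambda>i. axis i 1)"
      by (auto simp: Basis_vec_def)
    have inj: "inj (\<lambda>i::'n. axis i (1::real))"
      by (auto simp: inj_on_def axis_eq_axis)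
    show ?thesis unfolding B sum.reindex[OF inj] by simp
  qed
  then show ?thesis
    using frechet_derivative_at[OF assms]
    by (simp add: divergence_def jacobian_def trace_def matrix_def inner_axis)
qed

text \<open>
  The pair \<open>(v x t, 1)\<close> is the space-time direction of a particle path through \<open>(x, t)\<close>. The
  existence of the joint derivative allows the two partial derivatives of the equation to be added.
\<close>

lemma transport_equation_derivative:
  assumes "transport_equation T v \<rho>" and t: "0 < t" "t < T"
    and D: "((\<lambda>(x, s). \<rho> x s) has_derivative D) (at (x, t))"
  shows "D (v x t, 1) = 0"
proof -
  interpret D: bounded_linear D using D by (rule has_derivative_bounded_linear)
  obtain r g where r: "((\<lambda>s. \<rho> x s) has_real_derivative r) (at t within {0..<T})"
    and g: "GDERIV (\<lambda>y. \<rho> y t) x :> g" and rg: "r + v x t \<bullet> g = 0"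
    using assms unfolding transport_equation_def by fastforce
  have "at t within {0..<T} = at t"
    using t by (intro at_within_open_subset[of t "{0<..<T}"]) auto
  then have r: "((\<lambda>s. \<rho> x s) has_derivative (\<lambda>h. r * h)) (at t)"
    using r by (simp add: has_field_derivative_def)
  have "((\<lambda>s. (x, s)) has_derivative (\<lambda>h. (0, h))) (at t)"
    by (auto intro!: derivative_eq_intros)
  from has_derivative_compose[OF this D] have "(\<lambda>h. D (0, h)) = (\<lambda>h. r * h)"
    using r by (intro has_derivative_unique) auto
  then have "D (0, 1) = r" by (metis mult.right_neutral)
  moreover have "((\<lambda>y. (y, t)) has_derivative (\<lambda>h. (h, 0))) (at x)"
    by (auto intro!: derivative_eq_intros)
  from has_derivative_compose[OF this D] have "(\<lambda>h. D (h, 0)) = (\<lambda>h. h \<bullet> g)"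
    using g unfolding gderiv_def by (intro has_derivative_unique) auto
  then have "D (v x t, 0) = v x t \<bullet> g" by metis
  ultimately show ?thesis
    using D.add[of "(v x t, 0)" "(0, 1)"] rg by simp
qed

lemma in_Lp_imp_integrable_powr:
  fixes f :: "'a::euclidean_space \<Rightarrow> real"
  assumes "in_Lp p f" and "p < \<infinity>" and "f \<in> borel_measurable borel"
  shows "integrable lborel (\<lambda>x. \<bar>f x\<bar> powr enn2real p)"
proof (rule integrableI_nonneg)
  have "p \<noteq> \<infinity>"
    using assms(2) by auto
  then have "(\<integral>\<^sup>+ x. ennreal (\<bar>f x\<bar> powr enn2real p) \<partial>completion lborel) < \<infinity>"
    using assms(1) by (simp add: in_Lp_def)
  then show "(\<integral>\<^sup>+ x. ennreal (\<bar>f x\<bar> powr enn2real p) \<partial>lborel) < \<infinity>"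
    by (simp add: nn_integral_completion)
qed (use assms(3) in auto)

lemma bounded_gradient_linear_growth:
  fixes w :: "'a::real_normed_vector \<Rightarrow> 'b::real_normed_vector" and w' :: "'a \<Rightarrow>\<^sub>C ('a \<Rightarrow>\<^sub>L 'b)"
  assumes "\<And>x. (w has_derivative blinfun_apply (w' x)) (at x)"
  shows "norm (w x) \<le> norm (w 0) + norm w' * norm x"
proof -
  have "norm (w x - w 0) \<le> norm w' * norm (x - 0)"
    by (rule differentiable_bound[where S = UNIV and f' = "\<lambda>x. blinfun_apply (w' x)"])
      (use assms norm_bounded[of w'] in \<open>auto simp: norm_blinfun.rep_eq[symmetric]\<close>)
  then show ?thesis using norm_triangle_sub[of "w x" "w 0"] by simp
qed

section \<open>Vanishing of the density profile\<close>

theorem theorem2p3: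
  fixes \<alpha> \<beta> T :: real
    and v\<^sub>0 :: "real^'n \<Rightarrow> real^'n" and \<rho>\<^sub>0 :: "real^'n \<Rightarrow> real"
    and v :: "real^'n \<Rightarrow> real \<Rightarrow> real^'n" and \<rho> :: "real^'n \<Rightarrow> real \<Rightarrow> real"
    and V :: "real^'n \<Rightarrow> real^'n" and R :: "real^'n \<Rightarrow> real"
    and p\<^sub>1 p\<^sub>2 :: ennreal
  assumes "CARD('n) \<ge> 2"
    and "\<alpha> \<noteq> -1"
    and "T > 0"
    and "density_dependent_euler_solution T v\<^sub>0 \<rho>\<^sub>0 v \<rho>"
    and "\<forall>\<^sub>F t in at_left T. \<forall>x.
           v x t = (1 / (T - t) powr (\<alpha> / (\<alpha> + 1))) *\<^sub>R V (x /\<^sub>R (T - t) powr (1 / (\<alpha> + 1)))"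
    and "\<forall>\<^sub>F t in at_left T. \<forall>x.
           \<rho> x t = (1 / (T - t) powr \<beta>) * R (x /\<^sub>R (T - t) powr (1 / (\<alpha> + 1)))"
    and "0 < p\<^sub>1" and "p\<^sub>1 < p\<^sub>2" and "p\<^sub>2 \<le> \<infinity>"
    and "in_Lp p\<^sub>1 R" and "in_Lp p\<^sub>2 R"
  shows "\<forall>x. R x = 0"
proof
  fix x
  define \<gamma> where "\<gamma> = 1 / (\<alpha> + 1)"
  have \<gamma>: "\<gamma> \<noteq> 0" using \<open>\<alpha> \<noteq> -1\<close> by (simp add: \<gamma>_def eq_neg_iff_add_eq_0)
  have sol: "velocity_class T v" "C1_on (UNIV \<times> {0..<T}) (\<lambda>(x, t). \<rho> x t)"
    "\<And>x t. t \<in> {0..<T} \<Longrightarrow> \<rho> x t \<ge> 0" "transport_equation T v \<rho>" "incompressible T v"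
    using assms(4) by (auto simp: density_dependent_euler_solution_def)
  obtain a0 where "a0 < T" and form0: "\<And>s x. a0 < s \<Longrightarrow> s < T \<Longrightarrow>
      \<rho> x s = (1 / (T - s) powr \<beta>) * R (x /\<^sub>R (T - s) powr \<gamma>)"
    using assms(6) unfolding eventually_at_left_field \<gamma>_def by blast
  define a where "a = max 0 a0"
  \<comment> \<open>Any time that is positive and in the self-similar regime will do.\<close>
  define t where "t = (a + T) / 2"
  define \<tau> where "\<tau> = T - t"
  define L where "L = \<tau> powr \<gamma>"
  define k where "k = \<tau> powr (1 - \<gamma>)"
  have "a < T" using \<open>a0 < T\<close> \<open>T > 0\<close> by (simp add: a_def)
  then have t: "a < t" "t < T" "0 < t" by (auto simp: t_def a_def)
  then have tT: "t \<in> {0..<T}" by simp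
  have form: "\<rho> x s = (1 / (T - s) powr \<beta>) * R (x /\<^sub>R (T - s) powr \<gamma>)" if "a < s" "s < T" for s x
    using form0 that by (simp add: a_def)
  have L: "L > 0" using t by (simp add: L_def \<tau>_def)
  obtain D' where D': "\<And>z. z \<in> UNIV \<times> {0..<T} \<Longrightarrow>
        ((\<lambda>(x, t). \<rho> x t) has_derivative blinfun_apply (D' z)) (at z within UNIV \<times> {0..<T})"
    and D'_cont: "continuous_on (UNIV \<times> {0..<T}) D'"
    using sol(2) unfolding C1_on_def by blast
  have D: "((\<lambda>(x, t). \<rho> x t) has_derivative blinfun_apply (D' (x, t))) (at (x, t))" for x
  proof -
    have "at (x, t) within UNIV \<times> {0..<T} = at (x, t)"
      using t by (intro at_within_open_subset[of "(x, t)" "UNIV \<times> {0<..<T}"]) (auto intro!: open_Times)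
    then show ?thesis using D'[of "(x, t)"] tT by simp
  qed
  have transport: "D' (x, t) (v x t, 1) = 0" for x
    by (rule transport_equation_derivative[OF sol(4) t(3,2) D])
  define R' where "R' y z = \<tau> powr \<beta> * D' (L *\<^sub>R y, t) (L *\<^sub>R z, 0)" for y z
  \<comment> \<open>The similarity form of the velocity makes this \<open>V y + \<gamma> y\<close> for \<open>t\<close> close to \<open>T\<close>.\<close>
  define W where "W y = k *\<^sub>R v (L *\<^sub>R y) t + \<gamma> *\<^sub>R y" for y
  have dR: "(R has_derivative R' y) (at y)" and R'W: "R' y (W y) = - \<beta> * R y" for y
    using self_similar_profile[OF t(1,2) form D transport]
    unfolding R'_def[abs_def] W_def L_def k_def \<tau>_def by blast+
  have cR: "continuous_on UNIV (\<lambda>y. R' y b)" for b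
  proof -
    have "continuous_on UNIV (\<lambda>y. D' (L *\<^sub>R y, t))"
      using tT by (intro continuous_on_compose2[OF D'_cont] continuous_intros) auto
    then show ?thesis unfolding R'_def by (intro continuous_intros)
  qed
  have R0: "R y \<ge> 0" for y
  proof -
    have "R y = \<tau> powr \<beta> * \<rho> (L *\<^sub>R y) t"
      using form[OF t(1,2), of "L *\<^sub>R y"] t(2) by (simp add: L_def \<tau>_def)
    then show ?thesis using sol(3)[OF tT] by simp
  qed
  obtain G :: "real \<Rightarrow> ((real^'n) \<Rightarrow>\<^sub>C ((real^'n) \<Rightarrow>\<^sub>L (real^'n)))"
    where dv: "\<And>x. ((\<lambda>y. v y t) has_derivative blinfun_apply (G t x)) (at x)"
    using sol(1) tT unfolding velocity_class_def by blast
  define W' where "W' y z = k *\<^sub>R G t (L *\<^sub>R y) (L *\<^sub>R z) + \<gamma> *\<^sub>R z" for y z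
  have dW: "(W has_derivative W' y) (at y)" for y
  proof -
    have "((\<lambda>y. L *\<^sub>R y) has_derivative (\<lambda>z. L *\<^sub>R z)) (at y)"
      by (auto intro!: derivative_eq_intros)
    from has_derivative_compose[OF this dv] show ?thesis
      unfolding W_def[abs_def] W'_def[abs_def]
      by (intro has_derivative_add has_derivative_scaleR_right has_derivative_ident)
  qed
  have cW: "continuous_on UNIV (\<lambda>y. W' y b)" for b
  proof -
    have "continuous_on UNIV (\<lambda>y. G t (L *\<^sub>R y))"
      by (rule continuous_on_compose2[OF continuous_on_apply_bcontfun[of UNIV]])
        (auto intro!: continuous_intros)
    then show ?thesis unfolding W'_def by (intro continuous_intros)
  qed
  have div: "(\<Sum>b\<in>Basis. W' y b \<bullet> b) = real CARD('n) * \<gamma>" for y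
  proof -
    have "(\<Sum>b\<in>Basis. G t (L *\<^sub>R y) b \<bullet> b) = 0"
      using divergence_eq_sum_Basis[OF dv] sol(5) tT unfolding incompressible_def by metis
    \<comment> \<open>The velocity is divergence free, so only the dilation field contributes.\<close>
    moreover have "(\<Sum>b\<in>Basis. W' y b \<bullet> b) = k * L * (\<Sum>b\<in>Basis. G t (L *\<^sub>R y) b \<bullet> b) + (\<Sum>b\<in>(Basis::(real^'n) set). \<gamma>)"
      by (simp add: W'_def blinfun.scaleR_right inner_add_left sum.distrib sum_distrib_left mult.assoc)
    ultimately show ?thesis by simp
  qed
  have growth: "norm (W y) \<le> (k * norm (v 0 t) + k * norm (G t) * L + \<bar>\<gamma>\<bar>) * (1 + norm y)" for y
  proof -
    have "k \<ge> 0" by (simp add: k_def)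
    have "norm (W y) \<le> k * norm (v (L *\<^sub>R y) t) + \<bar>\<gamma>\<bar> * norm y"
      unfolding W_def using \<open>k \<ge> 0\<close> by (intro order_trans[OF norm_triangle_ineq]) simp
    also have "\<dots> \<le> k * (norm (v 0 t) + norm (G t) * norm (L *\<^sub>R y)) + \<bar>\<gamma>\<bar> * norm y"
      using \<open>k \<ge> 0\<close> bounded_gradient_linear_growth[OF dv] by (intro add_right_mono mult_left_mono)
    also have "\<dots> \<le> (k * norm (v 0 t) + k * norm (G t) * L + \<bar>\<gamma>\<bar>) * (1 + norm y)"
      using \<open>k \<ge> 0\<close> L by (simp add: algebra_simps)
    finally show ?thesis .
  qed
  have finite: "p\<^sub>1 < \<infinity>"
    using \<open>p\<^sub>1 < p\<^sub>2\<close> \<open>p\<^sub>2 \<le> \<infinity>\<close> by (rule less_le_trans)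
  then have p: "enn2real p\<^sub>1 > 0"
    using \<open>0 < p\<^sub>1\<close> by (simp add: enn2real_positive_iff)
  have "continuous_on UNIV R"
    using dR by (meson continuous_at_imp_continuous_on has_derivative_continuous)
  then have Rp: "integrable lborel (\<lambda>x. R x powr enn2real p\<^sub>1)"
    using in_Lp_imp_integrable_powr[OF \<open>in_Lp p\<^sub>1 R\<close> finite borel_measurable_continuous_onI] R0 by simp
  show "R x = 0"
    using \<gamma> by (intro stationary_profile_eq_0[OF dR cR R0 dW cW div _ growth R'W p Rp]) simp
qed

end
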